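(* For every integer $m\geq 3$ and every positive integer $n$, the cylinder $C(m,2n+1)=P_m\square C_{2n+1}$ is interval colorable, and $$w(C(m,2n+1))=\begin{cases}4,& \text{if } m \text{ is even},\\ 6,& \text{if } m \text{ is odd}.\end{cases}$$
   Context: All graphs are finite, undirected, without loops or multiple edges. An edge-coloring of a graph $G$ with colors $1,\ldots,t$ is an interval $t$-coloring if all $t$ colors are used, and the colors of the edges incident to each vertex are distinct and form an interval of consecutive integers. A graph is interval colorable if it has an interval $t$-coloring for some positive integer $t$; for such a graph, $w(G)$ is the least such $t$. $P_m$ is the path on $m$ vertices and $C_k$ the cycle on $k$ vertices. The Cartesian product $G\square H$ has vertex set $V(G)\times V(H)$, with $(u_1,v_1)(u_2,v_2)$ an edge iff either $u_1=u_2$ and $v_1v_2\in E(H)$, or $v_1=v_2$ and $u_1u_2\in E(G)$. *)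

theory Defs
  imports Main
begin

datatype 'a graph = Graph (verts: "'a set") (edges: "'a set set")

definition simple_graph :: "'a graph \<Rightarrow> bool" where
  "simple_graph G \<longleftrightarrow> finite (verts G) \<and> (\<forall>e\<in>edges G. e \<subseteq> verts G \<and> card e = 2)"

definition incident_edges :: "'a graph \<Rightarrow> 'a \<Rightarrow> 'a set set" where
  "incident_edges G v = {e \<in> edges G. v \<in> e}"

text \<open>An isolated vertex imposes no constraint: the empty set of colors is \<open>{a..b}\<close> with \<open>b < a\<close>.\<close>

definition interval_coloring :: "'a graph \<Rightarrow> nat \<Rightarrow> ('a set \<Rightarrow> nat) \<Rightarrow> bool" where
  "interval_coloring G t c \<longleftrightarrow>
     c ` edges G = {1..t} \<and>
     (\<forall>v\<in>verts G. inj_on c (incident_edges G v) \<and> (\<exists>a b. c ` incident_edges G v = {a..b}))"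

definition has_interval_coloring :: "'a graph \<Rightarrow> nat \<Rightarrow> bool" where
  "has_interval_coloring G t \<longleftrightarrow> (\<exists>c. interval_coloring G t c)"

definition interval_colorable :: "'a graph \<Rightarrow> bool" where
  "interval_colorable G \<longleftrightarrow> (\<exists>t\<ge>1. has_interval_coloring G t)"

text \<open>Only meaningful for interval colorable graphs.\<close>

definition w :: "'a graph \<Rightarrow> nat" where
  "w G = (LEAST t. t \<ge> 1 \<and> has_interval_coloring G t)"

definition path_graph :: "nat \<Rightarrow> nat graph" where
  "path_graph m = Graph {0..<m} {{i, i + 1} | i. i + 1 < m}"

text \<open>This is the cycle on \<open>k\<close> vertices for \<open>k \<ge> 3\<close>; smaller \<open>k\<close> give degenerate graphs.\<close>

definition cycle_graph :: "nat \<Rightarrow> nat graph" where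
  "cycle_graph k = Graph {0..<k} {{i, (i + 1) mod k} | i. i < k}"

definition cartesian_product :: "'a graph \<Rightarrow> 'b graph \<Rightarrow> ('a \<times> 'b) graph" where
  "cartesian_product G H = Graph (verts G \<times> verts H)
     {{(u1, v1), (u2, v2)} | u1 v1 u2 v2.
        (u1, v1) \<in> verts G \<times> verts H \<and> (u2, v2) \<in> verts G \<times> verts H \<and>
        (u1 = u2 \<and> {v1, v2} \<in> edges H \<or> v1 = v2 \<and> {u1, u2} \<in> edges G)}"

definition cylinder :: "nat \<Rightarrow> nat \<Rightarrow> (nat \<times> nat) graph" where
  "cylinder m k = cartesian_product (path_graph m) (cycle_graph k)"

lemma simple_path_graph: "simple_graph (path_graph m)"
  by (auto simp: simple_graph_def path_graph_def)

lemma simple_cycle_graph: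
  assumes "k \<ge> 3"
  shows "simple_graph (cycle_graph k)"
proof -
  have "i \<noteq> Suc i mod k \<and> Suc i mod k < k" if "i < k" for i
    using that assms by (cases "Suc i = k") auto
  then show ?thesis
    by (auto simp: simple_graph_def cycle_graph_def card_2_iff)
qed

lemma simple_graph_edge_neq:
  assumes "simple_graph G" "{u, v} \<in> edges G"
  shows "u \<noteq> v"
proof
  assume "u = v"
  moreover have "card {u, v} = 2"
    using assms unfolding simple_graph_def by blast
  ultimately show False by simp
qed

lemma simple_cartesian_product:
  assumes "simple_graph G" "simple_graph H"
  shows "simple_graph (cartesian_product G H)"
  unfolding simple_graph_def
proof (intro conjI ballI)
  show "finite (verts (cartesian_product G H))"
    using assms by (simp add: simple_graph_def cartesian_product_def)
next
  fix e assume "e \<in> edges (cartesian_product G H)"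
  then obtain u1 v1 u2 v2 where e: "e = {(u1, v1), (u2, v2)}"
    and V: "(u1, v1) \<in> verts G \<times> verts H" "(u2, v2) \<in> verts G \<times> verts H"
    and E: "u1 = u2 \<and> {v1, v2} \<in> edges H \<or> v1 = v2 \<and> {u1, u2} \<in> edges G"
    unfolding cartesian_product_def graph.sel mem_Collect_eq by (elim exE conjE) rule
  have "(u1, v1) \<noteq> (u2, v2)"
    using E simple_graph_edge_neq[OF assms(1)] simple_graph_edge_neq[OF assms(2)] by blast
  then show "card e = 2"
    unfolding e by simp
  show "e \<subseteq> verts (cartesian_product G H)"
    unfolding e cartesian_product_def graph.sel using V by simp
qed

lemma simple_cylinder: "k \<ge> 3 \<Longrightarrow> simple_graph (cylinder m k)"
  by (simp add: cylinder_def simple_cartesian_product simple_path_graph simple_cycle_graph)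

end

theory Submission
  imports Defs
begin

text \<open>
  An interior vertex has degree 4, so at least 4 colors are needed. If at most 5 colors are used,
  every interval of length at least 3 contains color 3, so the edges of color 3 form a perfect
  matching, which is impossible when the number \<open>m (2n + 1)\<close> of vertices is odd. Conversely, color
  each cycle \<open>2, 3, \<dots>, 2, 3, 1\<close> and let the edges between consecutive cycles be alternately
  \<open>3, 1, \<dots>, 1, 2\<close> and \<open>4, \<dots>, 4\<close>; for even \<open>m\<close> this is an interval 4-coloring. For odd \<open>m\<close> the same
  pattern is used from the third cycle on, the first two cycles being colored \<open>4, 3, \<dots>, 4, 3, 5\<close>
  with \<open>6, 2, \<dots>, 2, 4\<close> between them.
\<close>

section \<open>Graphs of odd order\<close>

text \<open>The members of \<open>M\<close> partition the vertex set into pairs, so the order is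
  twice the number of them.\<close>

lemma even_card_if_perfect_matching:
  assumes G: "simple_graph G" and M: "M \<subseteq> edges G"
    and cover: "\<And>v. v \<in> verts G \<Longrightarrow> \<exists>!e. e \<in> M \<and> v \<in> e"
  shows "even (card (verts G))"
proof -
  have sub: "e \<subseteq> verts G" and two: "card e = 2" if "e \<in> M" for e
    using G M that by (auto simp: simple_graph_def)
  have "verts G = \<Union>M"
    using cover sub by blast
  moreover have "card (\<Union>M) = (\<Sum>e\<in>M. card e)"
  proof (rule card_Union_disjoint)
    show "pairwise disjnt M"
      unfolding pairwise_def disjnt_def using cover sub by blast
    show "finite e" if "e \<in> M" for e
      \<comment> \<open>Infinite sets have cardinality 0, so cardinality 2 already forces
        finiteness.\<close>
      using two[OF that] card.infinite by fastforce
  qed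
  ultimately show ?thesis
    using two by simp
qed

lemma interval_coloring_ge_degree:
  assumes "interval_coloring G t c" and "v \<in> verts G"
  shows "card (incident_edges G v) \<le> t"
proof -
  have "inj_on c (incident_edges G v)" and "c ` incident_edges G v \<subseteq> {1..t}"
    using assms by (auto simp: interval_coloring_def incident_edges_def)
  then show ?thesis
    using card_inj_on_le[of c "incident_edges G v" "{1..t}"] by simp
qed

lemma interval_coloring_odd_order:
  assumes G: "simple_graph G" and c: "interval_coloring G t c" and odd: "odd (card (verts G))"
    and deg: "\<And>v. v \<in> verts G \<Longrightarrow> 3 \<le> card (incident_edges G v)"
  shows "6 \<le> t"
proof (rule ccontr)
  assume "\<not> 6 \<le> t"
  then have t: "t \<le> 5" by simp
  have "\<exists>!e. e \<in> {e \<in> edges G. c e = 3} \<and> v \<in> e" if v: "v \<in> verts G" for v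
  proof -
    let ?I = "incident_edges G v"
    obtain a b where inj: "inj_on c ?I" and ab: "c ` ?I = {a..b}"
      using c v unfolding interval_coloring_def by blast
    have "c ` ?I \<subseteq> {1..t}"
      using c by (auto simp: interval_coloring_def incident_edges_def)
    moreover have "card {a..b} \<ge> 3"
      using card_image[OF inj] deg[OF v] ab by simp
    \<comment> \<open>The color 3 is the midpoint of \<open>{1..5}\<close>: these bounds give
      \<open>a \<le> 3\<close> and \<open>3 \<le> b\<close>.\<close>
    ultimately have "1 \<le> a" "b \<le> 5" "a + 2 \<le> b"
      using t ab by auto
    then have "3 \<in> c ` ?I"
      by (simp add: ab)
    then obtain e where "e \<in> ?I" "c e = 3"
      by auto
    moreover from this have "e' = e" if "e' \<in> ?I" "c e' = 3" for e'
      using inj_onD[OF inj] that by simp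
    ultimately show ?thesis
      unfolding incident_edges_def by blast
  qed
  with even_card_if_perfect_matching[OF G, of "{e \<in> edges G. c e = 3}"] odd show False
    by blast
qed

section \<open>Edges of the cylinder\<close>

text \<open>Edges are indexed by their starting vertex, so that a coloring can be given by two
  functions of \<open>i\<close> and \<open>j\<close>; the index \<open>j = k - 1\<close> is the
  closing edge of a cycle.\<close>

definition cycle_edge :: "nat \<Rightarrow> nat \<Rightarrow> nat \<Rightarrow> (nat \<times> nat) set" where
  "cycle_edge k i j = {(i, j), (i, (j + 1) mod k)}"

definition path_edge :: "nat \<Rightarrow> nat \<Rightarrow> (nat \<times> nat) set" where
  "path_edge i j = {(i, j), (i + 1, j)}"

definition cycle_pred :: "nat \<Rightarrow> nat \<Rightarrow> nat" where
  "cycle_pred k j = (if j = 0 then k - 1 else j - 1)"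

lemma verts_cylinder: "verts (cylinder m k) = {0..<m} \<times> {0..<k}"
  by (simp add: cylinder_def cartesian_product_def path_graph_def cycle_graph_def)

lemma edges_cartesian_productI:
  assumes "e = {(u1, v1), (u2, v2)}"
    and "(u1, v1) \<in> verts G \<times> verts H" "(u2, v2) \<in> verts G \<times> verts H"
    and "u1 = u2 \<and> {v1, v2} \<in> edges H \<or> v1 = v2 \<and> {u1, u2} \<in> edges G"
  shows "e \<in> edges (cartesian_product G H)"
  using assms unfolding cartesian_product_def graph.sel mem_Collect_eq by blast

lemma edges_cylinder:
  assumes "k \<ge> 1"
  shows "edges (cylinder m k) =
    {cycle_edge k i j | i j. i < m \<and> j < k} \<union> {path_edge i j | i j. i + 1 < m \<and> j < k}"
proof (intro equalityI subsetI)
  fix e assume "e \<in> edges (cylinder m k)"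
  then obtain u1 v1 u2 v2 where e: "e = {(u1, v1), (u2, v2)}"
    and "(u1, v1) \<in> verts (path_graph m) \<times> verts (cycle_graph k)"
    and "(u2, v2) \<in> verts (path_graph m) \<times> verts (cycle_graph k)"
    and E: "u1 = u2 \<and> {v1, v2} \<in> edges (cycle_graph k) \<or>
      v1 = v2 \<and> {u1, u2} \<in> edges (path_graph m)"
    unfolding cylinder_def cartesian_product_def graph.sel mem_Collect_eq by (elim exE conjE) rule
  then have V: "u1 < m" "v1 < k" "u2 < m" "v2 < k"
    by (auto simp: path_graph_def cycle_graph_def)
  from E show "e \<in> {cycle_edge k i j | i j. i < m \<and> j < k} \<union>
      {path_edge i j | i j. i + 1 < m \<and> j < k}"
  proof
    assume "u1 = u2 \<and> {v1, v2} \<in> edges (cycle_graph k)"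
    then obtain j where "u1 = u2" "{v1, v2} = {j, (j + 1) mod k}" "j < k"
      by (auto simp: cycle_graph_def)
    then have "e = cycle_edge k u1 j"
      by (auto simp: e cycle_edge_def doubleton_eq_iff)
    then show ?thesis using V \<open>j < k\<close> by blast
  next
    assume "v1 = v2 \<and> {u1, u2} \<in> edges (path_graph m)"
    then obtain i where "v1 = v2" "{u1, u2} = {i, i + 1}" "i + 1 < m"
      by (auto simp: path_graph_def)
    then have "e = path_edge i v1"
      by (auto simp: e path_edge_def doubleton_eq_iff)
    then show ?thesis using V \<open>i + 1 < m\<close> by blast
  qed
next
  fix e assume "e \<in> {cycle_edge k i j | i j. i < m \<and> j < k} \<union>
      {path_edge i j | i j. i + 1 < m \<and> j < k}"
  then consider i j where "e = cycle_edge k i j" "i < m" "j < k"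
    | i j where "e = path_edge i j" "i + 1 < m" "j < k" by blast
  then show "e \<in> edges (cylinder m k)"
  proof cases
    case 1
    moreover have "(j + 1) mod k < k" using assms by simp
    moreover have "{j, (j + 1) mod k} \<in> edges (cycle_graph k)"
      using 1 by (auto simp: cycle_graph_def)
    ultimately show ?thesis
      unfolding cylinder_def
      by (intro edges_cartesian_productI[OF 1(1)[unfolded cycle_edge_def]])
        (simp_all add: path_graph_def cycle_graph_def)
  next
    case 2
    moreover have "{i, i + 1} \<in> edges (path_graph m)"
      using 2 by (auto simp: path_graph_def)
    ultimately show ?thesis
      unfolding cylinder_def
      by (intro edges_cartesian_productI[OF 2(1)[unfolded path_edge_def]])
        (simp_all add: path_graph_def cycle_graph_def)
  qed
qed

lemma cycle_pred_less: "j < k \<Longrightarrow> cycle_pred k j < k"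
  by (auto simp: cycle_pred_def)

lemma Suc_mod_eq_iff:
  assumes "k \<ge> 1" "j < k" "l < k"
  shows "Suc l mod k = j \<longleftrightarrow> l = cycle_pred k j"
  using assms by (cases "Suc l = k") (auto simp: cycle_pred_def)

lemma Suc_mod_cycle_pred: "k \<ge> 1 \<Longrightarrow> j < k \<Longrightarrow> Suc (cycle_pred k j) mod k = j"
  by (simp add: Suc_mod_eq_iff cycle_pred_less)

text \<open>The cycle edge with index \<open>l\<close> ends in column \<open>j\<close> exactly when
  \<open>Suc l mod k = j\<close>, that is, when \<open>l\<close> is the cyclic predecessor of
  \<open>j\<close>. The guards handle the two end cycles.\<close>

lemma incident_edges_cylinder:
  assumes k: "k \<ge> 1" and i: "i < m" and j: "j < k"
  shows "incident_edges (cylinder m k) (i, j) =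
    {cycle_edge k i j, cycle_edge k i (cycle_pred k j)} \<union>
    (if i + 1 < m then {path_edge i j} else {}) \<union> (if 0 < i then {path_edge (i - 1) j} else {})"
    (is "?L = ?R")
proof (intro equalityI subsetI)
  fix e assume "e \<in> ?L"
  then have e: "(i, j) \<in> e" "e \<in> edges (cylinder m k)"
    by (auto simp: incident_edges_def)
  from e(2) consider i' j' where "e = cycle_edge k i' j'" "i' < m" "j' < k"
    | i' j' where "e = path_edge i' j'" "i' + 1 < m" "j' < k"
    unfolding edges_cylinder[OF k] by blast
  then show "e \<in> ?R"
  proof cases
    case 1
    then have "i' = i" "j' = j \<or> j' = cycle_pred k j"
      using e(1) Suc_mod_eq_iff[OF k j 1(3)] by (auto simp: cycle_edge_def)
    then show ?thesis using 1 by auto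
  next
    case 2
    then show ?thesis using e(1) by (auto simp: path_edge_def)
  qed
next
  fix e assume e: "e \<in> ?R"
  have "(i, j) \<in> e"
    using e Suc_mod_cycle_pred[OF k j]
    by (auto simp: cycle_edge_def path_edge_def split: if_splits)
  moreover have "e \<in> edges (cylinder m k)"
    using e i j cycle_pred_less[OF j] unfolding edges_cylinder[OF k]
    by (fastforce split: if_splits)
  ultimately show "e \<in> ?L" by (simp add: incident_edges_def)
qed

definition cylinder_degree :: "nat \<Rightarrow> nat \<Rightarrow> nat" where
  "cylinder_degree m i = 2 + (if i + 1 < m then 1 else 0) + (if 0 < i then 1 else 0)"

text \<open>For \<open>k \<ge> 3\<close> the cyclic predecessor and successor of \<open>j\<close>
  differ, so the two cycle edges at a vertex are distinct. Path edges differ from cycle edges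
  because they change the first coordinate.\<close>

lemma card_incident_edges_cylinder:
  assumes k: "k \<ge> 3" and i: "i < m" and j: "j < k"
  shows "card (incident_edges (cylinder m k) (i, j)) = cylinder_degree m i"
proof -
  have "cycle_pred k j \<noteq> j" "cycle_pred k j \<noteq> Suc j mod k"
    using k j by (cases "Suc j = k"; auto simp: cycle_pred_def)+
  then have "cycle_edge k i j \<noteq> cycle_edge k i (cycle_pred k j)"
    by (auto simp: cycle_edge_def doubleton_eq_iff)
  moreover have "cycle_edge k i x \<noteq> path_edge y z" "path_edge y z \<noteq> cycle_edge k i x" for x y z
    by (auto simp: cycle_edge_def path_edge_def doubleton_eq_iff)
  moreover have "path_edge i j \<noteq> path_edge (i - 1) j" if "0 < i"
    using that by (auto simp: path_edge_def doubleton_eq_iff)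
  ultimately show ?thesis
    using k i j
    by (cases "i + 1 < m"; cases "0 < i") (simp_all add: incident_edges_cylinder cylinder_degree_def)
qed

section \<open>Colorings of the cylinder\<close>

text \<open>The two cases of the inner conditional separate the closing edge \<open>{0, k - 1}\<close> of a cycle from
  an edge \<open>{j, j + 1}\<close>.\<close>

definition edge_coloring ::
  "nat \<Rightarrow> (nat \<Rightarrow> nat \<Rightarrow> nat) \<Rightarrow> (nat \<Rightarrow> nat \<Rightarrow> nat) \<Rightarrow> (nat \<times> nat) set \<Rightarrow> nat" where
  "edge_coloring k h v e =
    (if is_singleton (fst ` e)
     then h (Min (fst ` e)) (if snd ` e = {0, k - 1} then k - 1 else Min (snd ` e))
     else v (Min (fst ` e)) (Min (snd ` e)))"

lemma edge_coloring_cycle_edge: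
  assumes "k \<ge> 3" "j < k"
  shows "edge_coloring k h v (cycle_edge k i j) = h i j"
proof (cases "Suc j = k")
  case True
  then have "snd ` cycle_edge k i j = {0, k - 1}"
    by (auto simp: cycle_edge_def)
  then show ?thesis
    using True by (auto simp: edge_coloring_def cycle_edge_def)
next
  case False
  then have "snd ` cycle_edge k i j = {j, Suc j}"
    using assms by (auto simp: cycle_edge_def)
  \<comment> \<open>Equality would need \<open>j = 0\<close> and \<open>k = 2\<close>.\<close>
  moreover have "{j, Suc j} \<noteq> {0, k - 1}"
    using assms by (auto simp: doubleton_eq_iff)
  ultimately show ?thesis
    by (auto simp: edge_coloring_def cycle_edge_def)
qed

lemma edge_coloring_path_edge: "edge_coloring k h v (path_edge i j) = v i j"
proof -
  have "\<not> is_singleton {i, Suc i}"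
    by (auto simp: is_singleton_def doubleton_eq_iff)
  then show ?thesis
    by (simp add: edge_coloring_def path_edge_def)
qed

text \<open>Distinctness at a vertex needs no separate check: if the colors there fill an interval
  as long as the degree, no two edges can share a color.\<close>

lemma cylinder_has_interval_coloring:
  assumes k: "k \<ge> 3"
    and used: "{h i j | i j. i < m \<and> j < k} \<union> {v i j | i j. i + 1 < m \<and> j < k} = {1..t}"
    and loc: "\<And>i j. i < m \<Longrightarrow> j < k \<Longrightarrow> \<exists>a.
      {h i j, h i (cycle_pred k j)} \<union> (if i + 1 < m then {v i j} else {}) \<union>
      (if 0 < i then {v (i - 1) j} else {}) = {a..<a + cylinder_degree m i}"
  shows "has_interval_coloring (cylinder m k) t"
proof -
  let ?G = "cylinder m k" and ?c = "edge_coloring k h v"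
  have k1: "k \<ge> 1" using k by simp
  note ce = edge_coloring_cycle_edge[OF k] edge_coloring_path_edge
  have "?c ` edges ?G = {h i j | i j. i < m \<and> j < k} \<union> {v i j | i j. i + 1 < m \<and> j < k}"
  proof -
    have image: "f ` {g i j | i j. P i j} = {f (g i j) | i j. P i j}"
      for f :: "(nat \<times> nat) set \<Rightarrow> nat" and g :: "nat \<Rightarrow> nat \<Rightarrow> (nat \<times> nat) set" and P
      by blast
    show ?thesis
      unfolding edges_cylinder[OF k1] image_Un image
      by (intro arg_cong2[where f = "(\<union>)"] Collect_cong ex_cong1) (auto simp: ce)
  qed
  then have "?c ` edges ?G = {1..t}"
    using used by simp
  moreover have "inj_on ?c (incident_edges ?G u) \<and> (\<exists>a b. ?c ` incident_edges ?G u = {a..b})"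
    if "u \<in> verts ?G" for u
  proof -
    obtain i j where u: "u = (i, j)" and ij: "i < m" "j < k"
      using \<open>u \<in> verts ?G\<close> by (auto simp: verts_cylinder)
    obtain a where a: "{h i j, h i (cycle_pred k j)} \<union> (if i + 1 < m then {v i j} else {}) \<union>
      (if 0 < i then {v (i - 1) j} else {}) = {a..<a + cylinder_degree m i}"
      using loc[OF ij] by blast
    have im: "?c ` incident_edges ?G u = {a..<a + cylinder_degree m i}"
      unfolding a[symmetric] u incident_edges_cylinder[OF k1 ij]
      using ij cycle_pred_less[OF ij(2)] by (simp add: ce)
    have "finite (incident_edges ?G u)"
      unfolding u incident_edges_cylinder[OF k1 ij] by simp
    then have "inj_on ?c (incident_edges ?G u)"
      using im card_incident_edges_cylinder[OF k ij] u by (intro eq_card_imp_inj_on) auto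
    \<comment> \<open>Degrees are at least 2, so the subtraction does not truncate.\<close>
    moreover have "{a..<a + cylinder_degree m i} = {a..a + cylinder_degree m i - 1}"
      by (auto simp: cylinder_degree_def)
    ultimately show ?thesis
      using im by blast
  qed
  ultimately have "interval_coloring ?G t ?c"
    by (simp add: interval_coloring_def)
  then show ?thesis
    by (auto simp: has_interval_coloring_def)
qed

section \<open>Color patterns on odd cycles and on the rungs between them\<close>

definition cycle_colors :: "nat \<Rightarrow> nat \<Rightarrow> nat" where
  "cycle_colors k j = (if j = k - 1 then 1 else if even j then 2 else 3)"

text \<open>The reflection of \<open>cycle_colors\<close> under the map sending a color
  \<open>x\<close> to \<open>6 - x\<close>.\<close>

definition cycle_colors' :: "nat \<Rightarrow> nat \<Rightarrow> nat" where
  "cycle_colors' k j = (if j = k - 1 then 5 else if even j then 4 else 3)"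

text \<open>For odd \<open>k \<ge> 3\<close> this is the one color among 1, 2, 3 that
  \<open>cycle_colors\<close> leaves free at vertex \<open>j\<close>.\<close>

definition rung_colors :: "nat \<Rightarrow> nat \<Rightarrow> nat" where
  "rung_colors k j = (if j = 0 then 3 else if j = k - 1 then 2 else 1)"

text \<open>Twice \<open>rung_colors\<close>. Together with \<open>cycle_colors'\<close> it yields
  three consecutive colors whose interval starts just above \<open>rung_colors k j\<close>.\<close>

definition rung_colors' :: "nat \<Rightarrow> nat \<Rightarrow> nat" where
  "rung_colors' k j = (if j = 0 then 6 else if j = k - 1 then 4 else 2)"

text \<open>The four claims serve, in this order, an end cycle and an inner cycle of the unprimed
  pattern, then the first and the second cycle when \<open>m\<close> is odd. Oddness of
  \<open>k\<close> makes the edge before the closing one have color 3 (in both patterns).\<close>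

lemma colors_at_vertex:
  assumes "k \<ge> 3" "odd k" "j < k"
  shows "\<exists>a. {cycle_colors k j, cycle_colors k (cycle_pred k j), rung_colors k j} = {a..<a+3}"
    and "\<exists>a. insert 4 {cycle_colors k j, cycle_colors k (cycle_pred k j), rung_colors k j} = {a..<a+4}"
    and "\<exists>a. {cycle_colors' k j, cycle_colors' k (cycle_pred k j), rung_colors' k j} = {a..<a+3}"
    and "\<exists>a. {cycle_colors' k j, cycle_colors' k (cycle_pred k j), rung_colors' k j, rung_colors k j}
      = {a..<a+4}"
proof -
  note defs = cycle_colors_def cycle_colors'_def rung_colors_def rung_colors'_def cycle_pred_def
  \<comment> \<open>The left end of the four-color interval on the second cycle; it coincides with
    \<open>rung_colors k j\<close>.\<close>
  define b :: nat where "b = (if j = 0 then 3 else if j = k - 1 then 2 else 1)"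
  consider "j = 0" | "j = k - 1" "j \<noteq> 0" | "0 < j" "j < k - 1" "even j"
    | "0 < j" "j < k - 1" "odd j"
    using assms by linarith
  then have P: "{cycle_colors k j, cycle_colors k (cycle_pred k j), rung_colors k j} = {1..<1+3} \<and>
    insert 4 {cycle_colors k j, cycle_colors k (cycle_pred k j), rung_colors k j} = {1..<1+4} \<and>
    {cycle_colors' k j, cycle_colors' k (cycle_pred k j), rung_colors' k j} = {b+1..<b+1+3} \<and>
    {cycle_colors' k j, cycle_colors' k (cycle_pred k j), rung_colors' k j, rung_colors k j}
      = {b..<b+4}"
  proof cases
    case 1
    then have "cycle_colors k j = 2" "cycle_colors k (cycle_pred k j) = 1" "rung_colors k j = 3"
      "cycle_colors' k j = 4" "cycle_colors' k (cycle_pred k j) = 5" "rung_colors' k j = 6" "b = 3"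
      using assms by (auto simp: defs b_def)
    then show ?thesis
      by simp auto
  next
    case 2
    then have "cycle_colors k j = 1" "cycle_colors k (cycle_pred k j) = 3" "rung_colors k j = 2"
      "cycle_colors' k j = 5" "cycle_colors' k (cycle_pred k j) = 3" "rung_colors' k j = 4" "b = 2"
      using assms by (auto simp: defs b_def)
    then show ?thesis
      by simp auto
  next
    case 3
    then have "cycle_colors k j = 2" "cycle_colors k (cycle_pred k j) = 3" "rung_colors k j = 1"
      "cycle_colors' k j = 4" "cycle_colors' k (cycle_pred k j) = 3" "rung_colors' k j = 2" "b = 1"
      using assms by (auto simp: defs b_def)
    then show ?thesis
      by simp auto
  next
    case 4
    then have "cycle_colors k j = 3" "cycle_colors k (cycle_pred k j) = 2" "rung_colors k j = 1"
      "cycle_colors' k j = 3" "cycle_colors' k (cycle_pred k j) = 4" "rung_colors' k j = 2" "b = 1"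
      using assms by (auto simp: defs b_def)
    then show ?thesis
      by simp auto
  qed
  show "\<exists>a. {cycle_colors k j, cycle_colors k (cycle_pred k j), rung_colors k j} = {a..<a+3}"
    and "\<exists>a. insert 4 {cycle_colors k j, cycle_colors k (cycle_pred k j), rung_colors k j} = {a..<a+4}"
    and "\<exists>a. {cycle_colors' k j, cycle_colors' k (cycle_pred k j), rung_colors' k j} = {a..<a+3}"
    and "\<exists>a. {cycle_colors' k j, cycle_colors' k (cycle_pred k j), rung_colors' k j, rung_colors k j}
      = {a..<a+4}"
    using P by metis+
qed

text \<open>The cycles are grouped into consecutive pairs joined by the free colors, and color 4
  joins one pair to the next. For even \<open>m\<close> no cycle is left over, so both end cycles
  see exactly the colors 1, 2, 3.\<close>

lemma cylinder_even_coloring: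
  assumes m: "m \<ge> 3" "even m" and k: "k \<ge> 3" "odd k"
  shows "has_interval_coloring (cylinder m k) 4"
proof -
  define v where "v i j = (if odd i then 4 else rung_colors k j)" for i j :: nat
  show ?thesis
  proof (rule cylinder_has_interval_coloring[OF k(1)])
    let ?U = "{cycle_colors k j | i j. i < m \<and> j < k} \<union> {v i j | i j. i + 1 < m \<and> j < k}"
    show "?U = {1..4}"
    proof
      have "cycle_colors k j \<in> {1..4}" "v i j \<in> {1..4}" for i j
        by (simp_all add: v_def cycle_colors_def rung_colors_def)
      then show "?U \<subseteq> {1..4}"
        by blast
      have "1 = cycle_colors k (k - 1)" "2 = cycle_colors k 0" "3 = cycle_colors k 1" "4 = v 1 0"
        using k by (auto simp: v_def cycle_colors_def)
      moreover have "0 < m" "1 + 1 < m" "k - 1 < k" "0 < k" "1 < k"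
        using m k by auto
      ultimately have "{1, 2, 3, 4} \<subseteq> ?U" by blast
      moreover have "{1..4} = {1, 2, 3, 4::nat}" by auto
      ultimately show "{1..4} \<subseteq> ?U" by simp
    qed
    fix i j assume "i < m" and j: "j < k"
    note A = colors_at_vertex(1,2)[OF k j]
    \<comment> \<open>The last cycle has odd index, so the rungs leading to it have even index and
      carry \<open>rung_colors\<close>.\<close>
    have "i + 1 < m \<or> odd i" using m \<open>i < m\<close> by presburger
    then consider "i = 0" | "0 < i" "i + 1 < m" | "0 < i" "i + 1 = m" "odd i"
      using \<open>i < m\<close> by linarith
    then show "\<exists>a. {cycle_colors k j, cycle_colors k (cycle_pred k j)} \<union>
        (if i + 1 < m then {v i j} else {}) \<union> (if 0 < i then {v (i - 1) j} else {}) =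
        {a..<a + cylinder_degree m i}" (is "\<exists>a. ?S = _")
    proof cases
      case 1
      then have "?S = {cycle_colors k j, cycle_colors k (cycle_pred k j), rung_colors k j}"
        and "cylinder_degree m i = 3"
        using m by (auto simp: v_def cylinder_degree_def)
      then show ?thesis
        using A(1) by simp
    next
      case 2
      then have "?S = insert 4 {cycle_colors k j, cycle_colors k (cycle_pred k j), rung_colors k j}"
        and "cylinder_degree m i = 4"
        using m by (auto simp: v_def cylinder_degree_def)
      then show ?thesis
        using A(2) by simp
    next
      case 3
      then have "?S = {cycle_colors k j, cycle_colors k (cycle_pred k j), rung_colors k j}"
        and "cylinder_degree m i = 3"
        using m by (auto simp: v_def cylinder_degree_def)
      then show ?thesis
        using A(1) by simp
    qed
  qed
qed

text \<open>Plain alternation would bring color 4 to the last cycle, where color 3 is missing at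
  column 0. The primed pattern on the first two cycles shifts the parity: the second cycle sends
  \<open>rung_colors\<close> on to the third, where the alternation resumes.\<close>

lemma cylinder_odd_coloring:
  assumes m: "m \<ge> 3" "odd m" and k: "k \<ge> 3" "odd k"
  shows "has_interval_coloring (cylinder m k) 6"
proof -
  define h where "h i j = (if i < 2 then cycle_colors' k j else cycle_colors k j)" for i j :: nat
  define v where "v i j = (if i = 0 then rung_colors' k j else if even i then 4
    else rung_colors k j)" for i j :: nat
  show ?thesis
  proof (rule cylinder_has_interval_coloring[OF k(1)])
    let ?U = "{h i j | i j. i < m \<and> j < k} \<union> {v i j | i j. i + 1 < m \<and> j < k}"
    show "?U = {1..6}"
    proof
      have "h i j \<in> {1..6}" "v i j \<in> {1..6}" for i j
        by (simp_all add: h_def v_def cycle_colors_def rung_colors_def cycle_colors'_def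
            rung_colors'_def)
      then show "?U \<subseteq> {1..6}"
        by blast
      \<comment> \<open>Color 6 occurs on a single edge, the rung from \<open>(0, 0)\<close> to
        \<open>(1, 0)\<close>.\<close>
      have "1 = h 2 (k - 1)" "2 = h 2 0" "3 = h 0 1" "4 = h 0 0" "5 = h 0 (k - 1)" "6 = v 0 0"
        using k by (auto simp: h_def v_def cycle_colors_def cycle_colors'_def rung_colors'_def)
      moreover have "0 < m" "2 < m" "0 + 1 < m" "k - 1 < k" "0 < k" "1 < k"
        using m k by auto
      ultimately have "{1, 2, 3, 4, 5, 6} \<subseteq> ?U" by blast
      moreover have "{1..6} = {1, 2, 3, 4, 5, 6::nat}" by auto
      ultimately show "{1..6} \<subseteq> ?U" by simp
    qed
    fix i j assume "i < m" and j: "j < k"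
    note A = colors_at_vertex[OF k j]
    have "i + 1 < m \<or> even i" using m \<open>i < m\<close> by presburger
    then consider "i = 0" | "i = 1" | "2 \<le> i" "i + 1 < m" | "2 \<le> i" "i + 1 = m" "even i"
      using \<open>i < m\<close> by linarith
    then show "\<exists>a. {h i j, h i (cycle_pred k j)} \<union>
        (if i + 1 < m then {v i j} else {}) \<union> (if 0 < i then {v (i - 1) j} else {}) =
        {a..<a + cylinder_degree m i}" (is "\<exists>a. ?S = _")
    proof cases
      case 1
      then have "?S = {cycle_colors' k j, cycle_colors' k (cycle_pred k j), rung_colors' k j}"
        and "cylinder_degree m i = 3"
        using m by (auto simp: h_def v_def cylinder_degree_def)
      then show ?thesis
        using A(3) by simp
    next
      case 2
      then have "?S = {cycle_colors' k j, cycle_colors' k (cycle_pred k j), rung_colors' k j,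
          rung_colors k j}"
        and "cylinder_degree m i = 4"
        using m by (auto simp: h_def v_def cylinder_degree_def)
      then show ?thesis
        using A(4) by simp
    next
      case 3
      then have "?S = insert 4 {cycle_colors k j, cycle_colors k (cycle_pred k j), rung_colors k j}"
        and "cylinder_degree m i = 4"
        using m by (auto simp: h_def v_def cylinder_degree_def)
      then show ?thesis
        using A(2) by simp
    next
      case 4
      then have "?S = {cycle_colors k j, cycle_colors k (cycle_pred k j), rung_colors k j}"
        and "cylinder_degree m i = 3"
        using m by (auto simp: h_def v_def cylinder_degree_def)
      then show ?thesis
        using A(1) by simp
    qed
  qed
qed

section \<open>The least number of colors\<close>

theorem theorem16:
  fixes m n :: nat
  assumes "m \<ge> 3" and "n \<ge> 1"
  shows "interval_colorable (cylinder m (2 * n + 1)) \<and>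
         w (cylinder m (2 * n + 1)) = (if even m then 4 else 6)"
proof -
  define k where "k = 2 * n + 1"
  define s :: nat where "s = (if even m then 4 else 6)"
  \<comment> \<open>Here \<open>n \<ge> 1\<close> excludes the degenerate
    \<open>cycle_graph 1\<close>.\<close>
  have k: "k \<ge> 3" "odd k"
    using assms by (auto simp: k_def)
  have ex: "has_interval_coloring (cylinder m k) s"
    using cylinder_even_coloring cylinder_odd_coloring assms(1) k by (simp add: s_def)
  have lower: "s \<le> t" if t: "has_interval_coloring (cylinder m k) t" for t
  proof -
    obtain c where c: "interval_coloring (cylinder m k) t c"
      using t unfolding has_interval_coloring_def by blast
    show ?thesis
    proof (cases "even m")
      case True
      \<comment> \<open>Since \<open>m \<ge> 3\<close>, the second cycle is an inner one.\<close>
      have "card (incident_edges (cylinder m k) (1, 0)) = 4"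
        using assms k by (subst card_incident_edges_cylinder) (auto simp: cylinder_degree_def)
      then show ?thesis
        using interval_coloring_ge_degree[OF c, of "(1, 0)"] assms k True
        by (simp add: verts_cylinder s_def)
    next
      case False
      have "3 \<le> card (incident_edges (cylinder m k) u)" if "u \<in> verts (cylinder m k)" for u
        using that assms(1) k
        by (auto simp: verts_cylinder card_incident_edges_cylinder cylinder_degree_def)
      moreover have "odd (card (verts (cylinder m k)))"
        using False k by (simp add: verts_cylinder)
      ultimately show ?thesis
        using interval_coloring_odd_order[OF simple_cylinder[OF k(1)] c] False
        by (simp add: s_def)
    qed
  qed
  have "s \<ge> 1" by (simp add: s_def)
  then have "interval_colorable (cylinder m k)" and "w (cylinder m k) = s"
    using ex lower by (auto simp: interval_colorable_def w_def intro: Least_equality)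
  then show ?thesis
    by (simp add: k_def s_def)
qed

end
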